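(* Let $d\ge2$. For every $\Lambda\in\mathcal L_d$, $\mu(\Lambda)\le q^{-d}$.
   Context: Let $q$ be a prime power, $\mathcal R=\mathbb F_q[x]$, and $\tilde{\mathcal K}=\mathbb F_q((x^{-1}))$, with the absolute value $|\cdot|$ extending $|f|=q^{\deg f}$ for nonzero $f\in\mathcal R$ (and $|0|=0$). $\mathcal L_d$ is the space of unimodular lattices in $\tilde{\mathcal K}^d$, i.e. sets $g\mathcal R^d$ with $g$ an invertible $d\times d$ matrix over $\tilde{\mathcal K}$ with $|\det(g)|=1$. Let $N(\mathbf v)=\prod_{i=1}^d|v_i|$ for $\mathbf v\in\tilde{\mathcal K}^d$. The Minkowski function is $\mu(\Lambda)=\sup_{\mathbf v\in\tilde{\mathcal K}^d}\inf_{\mathbf u\in\Lambda}N(\mathbf v-\mathbf u)$; equivalently, $\mu(\Lambda)$ is the smallest $r\geq 0$ such that for every $R>r$ one has $\Lambda+\{\mathbf v\in\tilde{\mathcal K}^d:N(\mathbf v)<R\}=\tilde{\mathcal K}^d$. *)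

theory Defs
  imports "HOL-Analysis.Analysis" "HOL-Computational_Algebra.Computational_Algebra"
begin

(* The ground field F_q is a type 'a :: {field, finite}, with q = CARD('a).  The completion
   F_q((1/x)) is the library's field 'a fls of formal Laurent series, whose variable fls_X
   stands for 1/x; thus x is fls_X_inv, and a series with fls_subdegree n starts with the
   term of x-exponent -n. *)

definition poly_to_K :: "'a::field poly \<Rightarrow> 'a fls" where
  "poly_to_K p = poly (map_poly fls_const p) fls_X_inv"

definition K_abs :: "'a::{field,finite} fls \<Rightarrow> real" where
  "K_abs f = (if f = 0 then 0 else real CARD('a) powi (- fls_subdegree f))"

definition integer_vectors :: "('a::field fls ^ 'd::finite) set" where
  "integer_vectors = {v. \<forall>i. v $ i \<in> range poly_to_K}"

definition unimodular_lattices :: "('a::{field,finite} fls ^ 'd::finite) set set" where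
  "unimodular_lattices =
     {(\<lambda>v. g *v v) ` integer_vectors | g :: 'a fls ^ 'd ^ 'd. invertible g \<and> K_abs (det g) = 1}"

definition vec_N :: "'a::{field,finite} fls ^ 'd::finite \<Rightarrow> real" where
  "vec_N v = (\<Prod>i\<in>UNIV. K_abs (v $ i))"

(* Valued in ennreal so that the supremum is meaningful without presupposing boundedness. *)
definition minkowski_mu :: "('a::{field,finite} fls ^ 'd::finite) set \<Rightarrow> ennreal" where
  "minkowski_mu L = (SUP v. INF u\<in>L. ennreal (vec_N (v - u)))"

lemma poly_to_K_nth: "fls_nth (poly_to_K p) n = (if n \<le> 0 then coeff p (nat (- n)) else 0)"
proof (induction p arbitrary: n)
  case 0
  show ?case by (simp add: poly_to_K_def)
next
  case (pCons a p)
  have eq: "poly_to_K (pCons a p) = fls_const a + fls_X_inv * poly_to_K p"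
    using pCons.hyps by (simp add: poly_to_K_def map_poly_pCons)
  have "fls_nth (fls_const a + fls_X_inv * poly_to_K p) n = (if n = 0 then a else 0) + fls_nth (poly_to_K p) (n + 1)"
    by (simp add: fls_X_inv_times_conv_shift)
  also have "\<dots> = (if n \<le> 0 then coeff (pCons a p) (nat (- n)) else 0)"
    by (auto simp: pCons.IH coeff_pCons nat_diff_distrib' split: nat.splits)
  finally show ?case by (simp add: eq)
qed

lemma K_abs_poly_to_K:
  fixes p :: "'a::{field,finite} poly"
  assumes "p \<noteq> 0"
  shows "K_abs (poly_to_K p) = real CARD('a) ^ degree p"
proof -
  have lead: "fls_nth (poly_to_K p) (- int (degree p)) \<noteq> 0"
    using assms by (simp add: poly_to_K_nth)
  have "fls_subdegree (poly_to_K p) = - int (degree p)"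
    by (rule fls_subdegree_eqI[OF lead]) (auto simp: poly_to_K_nth intro!: coeff_eq_0)
  moreover have "poly_to_K p \<noteq> 0"
    using lead by auto
  ultimately show ?thesis
    by (simp add: K_abs_def)
qed

end

theory Submission
  imports Defs
begin

text \<open>
  Call the box with exponents \<open>n\<close> the set of vectors whose \<open>l\<close>-th entry has degree at most
  \<open>n l\<close> (degree in \<open>x\<close>, the variable of the Laurent series being \<open>1/x\<close>). The theorem follows
  once some \<open>n\<close> of total \<open>0\<close> admits \<open>d\<close> lattice vectors \<open>b\<^sub>k\<close> inside its box whose determinant
  is that of the lattice: an arbitrary \<open>v\<close> is a combination \<open>\<Sum> y\<^sub>k b\<^sub>k\<close>, and rounding each
  \<open>y\<^sub>k\<close> to its polynomial part yields a lattice vector \<open>u\<close> for which the entries of \<open>v - u\<close> have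
  degree at most \<open>n l - 1\<close>. Multiplying over the \<open>d\<close> coordinates gives \<open>N (v - u) \<le> q^(-d)\<close>
  (\<open>box_approximation\<close>).

  To find such vectors, allow also a weight \<open>e k\<close> for each vector and require the entry \<open>(k, l)\<close>
  to have degree at most \<open>n l + e k\<close>. The coefficients in exactly this degree form a matrix over
  the residue field whose determinant is the coefficient of the full determinant in degree
  \<open>\<Sum> n + \<Sum> e\<close> (\<open>coeff_at_det\<close>). As the full determinant has degree \<open>0\<close>, the leading matrix is
  singular as long as \<open>\<Sum> n + \<Sum> e > 0\<close>, and nonsingular when the total is \<open>0\<close>. Each of the two
  situations permits a determinant-preserving step.

  If the leading matrix is singular, a linear relation among its rows cancels the leading terms of
  one vector and lowers its weight (\<open>lower_row_weight\<close>). This is lattice reduction, and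
  it makes the total weight \<open>0\<close> (\<open>reduced_frame_exists\<close>).

  If the leading matrix is nonsingular, a vector of smallest weight can be used as a pivot: it has a
  nonzero leading coefficient in some coordinate \<open>i\<close>, and clearing that coefficient from the other
  vectors makes it possible to trade one unit of \<open>n i\<close> for one unit of the smallest weight
  (\<open>transfer_weight\<close>). In geometric terms, the diagonal group moves the lattice so that its
  successive minima come closer together. Starting from a reduced frame with all weights \<open>\<le> 0\<close>,
  which a constant shift between \<open>n\<close> and \<open>e\<close> provides, the steps end with all weights equal to
  \<open>0\<close> and hence with \<open>\<Sum> n = 0\<close> (\<open>balanced_frame_exists\<close>).
\<close>

(* Only the vector notation for the dollar sign is wanted; the same symbol for coefficients of
   power series would make every matrix entry ambiguous. *)
no_notation fps_nth (infixl "$" 75)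

section \<open>Degrees and leading coefficients\<close>

text \<open>The library's subdegree of \<open>0\<close> is \<open>0\<close>, whereas the zero series should satisfy every degree
  bound. A condition on the coefficients achieves this and is closed under sums.\<close>

definition deg_le :: "'a::zero fls \<Rightarrow> int \<Rightarrow> bool" where
  "deg_le f m \<longleftrightarrow> (\<forall>k < - m. fls_nth f k = 0)"

text \<open>The coefficient of \<open>x^m\<close>. Combined with \<open>deg_le f m\<close> it is the leading coefficient
  relative to the bound \<open>m\<close>; it may vanish.\<close>

definition coeff_at :: "'a::zero fls \<Rightarrow> int \<Rightarrow> 'a" where
  "coeff_at f m = fls_nth f (- m)"

lemma deg_le_iff: "deg_le f m \<longleftrightarrow> f = 0 \<or> - m \<le> fls_subdegree f"
proof
  assume "deg_le f m"
  then show "f = 0 \<or> - m \<le> fls_subdegree f"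
    unfolding deg_le_def using nth_fls_subdegree_nonzero not_le by blast
next
  assume "f = 0 \<or> - m \<le> fls_subdegree f"
  then show "deg_le f m"
    unfolding deg_le_def by (auto simp: fls_eq0_below_subdegree)
qed

lemma deg_le_mono: "deg_le f m \<Longrightarrow> m \<le> m' \<Longrightarrow> deg_le f m'"
  by (auto simp: deg_le_def)

lemma deg_le_add: "deg_le f m \<Longrightarrow> deg_le g m \<Longrightarrow> deg_le (f + g) m"
  for f g :: "'a::monoid_add fls"
  by (auto simp: deg_le_def)

lemma deg_le_sum: "(\<And>i. i \<in> S \<Longrightarrow> deg_le (f i) m) \<Longrightarrow> deg_le (\<Sum>i\<in>S. f i) m"
  for f :: "'b \<Rightarrow> 'a::comm_monoid_add fls"
  by (auto simp: deg_le_def fls_nth_sum intro!: sum.neutral)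

lemma deg_le_pred: "deg_le f m \<Longrightarrow> coeff_at f m = 0 \<Longrightarrow> deg_le f (m - 1)"
proof -
  assume f: "deg_le f m" "coeff_at f m = 0"
  have "fls_nth f k = 0" if "k < - (m - 1)" for k
    using f that by (cases "k = - m") (auto simp: deg_le_def coeff_at_def)
  then show "deg_le f (m - 1)"
    by (simp add: deg_le_def)
qed

lemma coeff_at_eq_0: "deg_le f m \<Longrightarrow> m < m' \<Longrightarrow> coeff_at f m' = 0"
  by (auto simp: deg_le_def coeff_at_def)

lemma coeff_at_add: "coeff_at (f + g) m = coeff_at f m + coeff_at g m"
  for f g :: "'a::monoid_add fls"
  by (simp add: coeff_at_def)

lemma coeff_at_sum: "coeff_at (\<Sum>i\<in>S. f i) m = (\<Sum>i\<in>S. coeff_at (f i) m)"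
  for f :: "'b \<Rightarrow> 'a::comm_monoid_add fls"
  by (simp add: coeff_at_def fls_nth_sum)

lemma deg_le_mult:
  fixes f g :: "'a::idom fls"
  assumes "deg_le f m" "deg_le g k"
  shows "deg_le (f * g) (m + k)"
  using assms by (cases "f = 0 \<or> g = 0") (auto simp: deg_le_iff)

lemma coeff_at_mult:
  fixes f g :: "'a::idom fls"
  assumes "deg_le f m" "deg_le g k"
  shows "coeff_at (f * g) (m + k) = coeff_at f m * coeff_at g k"
proof (cases "f = 0 \<or> g = 0")
  case False
  then have ge: "- m \<le> fls_subdegree f" "- k \<le> fls_subdegree g"
    using assms by (auto simp: deg_le_iff)
  show ?thesis
  proof (cases "fls_subdegree f = - m \<and> fls_subdegree g = - k")
    case True
    then show ?thesis
      by (simp add: coeff_at_def fls_times_nth(2))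
  next
    case False
    then have "fls_nth f (- m) = 0 \<or> fls_nth g (- k) = 0"
      using ge by (metis fls_eq0_below_subdegree order_le_less)
    moreover have "fls_nth (f * g) (- (m + k)) = 0"
      using ge False by (intro fls_times_nth_eq0) auto
    ultimately show ?thesis
      by (auto simp: coeff_at_def)
  qed
qed (auto simp: coeff_at_def)

lemma deg_le_prod:
  fixes f :: "'b \<Rightarrow> 'a::idom fls"
  assumes "finite S" "\<And>i. i \<in> S \<Longrightarrow> deg_le (f i) (m i)"
  shows "deg_le (\<Prod>i\<in>S. f i) (\<Sum>i\<in>S. m i)"
  using assms
proof (induction rule: finite_induct)
  case empty
  show ?case by (simp add: deg_le_def)
next
  case (insert i S)
  then show ?case by (simp add: deg_le_mult)
qed

lemma coeff_at_prod:
  fixes f :: "'b \<Rightarrow> 'a::idom fls"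
  assumes "finite S" "\<And>i. i \<in> S \<Longrightarrow> deg_le (f i) (m i)"
  shows "coeff_at (\<Prod>i\<in>S. f i) (\<Sum>i\<in>S. m i) = (\<Prod>i\<in>S. coeff_at (f i) (m i))"
  using assms
proof (induction rule: finite_induct)
  case empty
  show ?case by (simp add: coeff_at_def)
next
  case (insert i S)
  then show ?case by (simp add: coeff_at_mult deg_le_prod)
qed

lemma deg_le_of_int: "deg_le (of_int z :: 'a::ring_1 fls) 0"
  by (simp add: deg_le_def fls_of_int_nth)

lemma coeff_at_of_int: "coeff_at (of_int z :: 'a::ring_1 fls) 0 = of_int z"
  by (simp add: coeff_at_def fls_of_int_nth)

text \<open>Along every permutation the weights add up to the same total, so that every term of the
  Leibniz expansion has the same degree bound and the leading terms form a determinant again.\<close>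

lemma leibniz_weight_sum:
  fixes n e :: "'d::finite \<Rightarrow> int"
  assumes "p permutes (UNIV :: 'd set)"
  shows "(\<Sum>k\<in>UNIV. n (p k) + e k) = sum n UNIV + sum e UNIV"
  using sum.permute[OF assms, of n] by (simp add: sum.distrib o_def)

lemma leibniz_term:
  fixes B :: "'a::idom fls ^ 'd::finite ^ 'd"
  assumes B: "\<And>k l. deg_le (B $ k $ l) (n l + e k)" and p: "p permutes (UNIV :: 'd set)"
  shows "deg_le (of_int (sign p) * (\<Prod>k\<in>UNIV. B $ k $ p k)) (sum n UNIV + sum e UNIV)"
    and "coeff_at (of_int (sign p) * (\<Prod>k\<in>UNIV. B $ k $ p k)) (sum n UNIV + sum e UNIV) =
      of_int (sign p) * (\<Prod>k\<in>UNIV. coeff_at (B $ k $ p k) (n (p k) + e k))"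
proof -
  have prod: "deg_le (\<Prod>k\<in>UNIV. B $ k $ p k) (sum n UNIV + sum e UNIV)"
    "coeff_at (\<Prod>k\<in>UNIV. B $ k $ p k) (sum n UNIV + sum e UNIV) =
      (\<Prod>k\<in>UNIV. coeff_at (B $ k $ p k) (n (p k) + e k))"
    using deg_le_prod[of UNIV "\<lambda>k. B $ k $ p k" "\<lambda>k. n (p k) + e k"]
      coeff_at_prod[of UNIV "\<lambda>k. B $ k $ p k" "\<lambda>k. n (p k) + e k"] B
    by (simp_all add: leibniz_weight_sum[OF p])
  show "deg_le (of_int (sign p) * (\<Prod>k\<in>UNIV. B $ k $ p k)) (sum n UNIV + sum e UNIV)"
    using deg_le_mult[OF deg_le_of_int prod(1)] by simp
  show "coeff_at (of_int (sign p) * (\<Prod>k\<in>UNIV. B $ k $ p k)) (sum n UNIV + sum e UNIV) =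
      of_int (sign p) * (\<Prod>k\<in>UNIV. coeff_at (B $ k $ p k) (n (p k) + e k))"
    using coeff_at_mult[OF deg_le_of_int prod(1)] prod(2) by (simp add: coeff_at_of_int)
qed

lemma deg_le_det:
  fixes B :: "'a::idom fls ^ 'd::finite ^ 'd"
  assumes "\<And>k l. deg_le (B $ k $ l) (n l + e k)"
  shows "deg_le (det B) (sum n UNIV + sum e UNIV)"
  unfolding det_def by (intro deg_le_sum leibniz_term(1) assms) auto

lemma coeff_at_det:
  fixes B :: "'a::idom fls ^ 'd::finite ^ 'd"
  assumes "\<And>k l. deg_le (B $ k $ l) (n l + e k)"
  shows "coeff_at (det B) (sum n UNIV + sum e UNIV) =
    det (\<chi> k l. coeff_at (B $ k $ l) (n l + e k))"
  unfolding det_def coeff_at_sum vec_lambda_beta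
  by (intro sum.cong leibniz_term(2) assms) auto

section \<open>Polynomials inside the Laurent series\<close>

lemma poly_to_K_0: "poly_to_K 0 = 0"
  by (simp add: poly_to_K_def)

lemma poly_to_K_1: "poly_to_K 1 = 1"
  by (simp add: poly_to_K_def)

lemma poly_to_K_add: "poly_to_K (p + q) = poly_to_K p + poly_to_K q"
  by (rule fls_eqI) (simp add: poly_to_K_nth)

lemma poly_to_K_pCons: "poly_to_K (pCons a p) = fls_const a + fls_X_inv * poly_to_K p"
  by (cases "a = 0 \<and> p = 0") (auto simp: poly_to_K_def map_poly_pCons)

lemma poly_to_K_smult: "poly_to_K (smult a p) = fls_const a * poly_to_K p"
  by (rule fls_eqI) (simp add: poly_to_K_nth)

lemma poly_to_K_mult: "poly_to_K (p * q) = poly_to_K p * poly_to_K q"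
proof (induction p)
  case 0
  show ?case by (simp add: poly_to_K_0)
next
  case (pCons a p)
  then show ?case
    by (simp add: poly_to_K_add poly_to_K_smult poly_to_K_pCons algebra_simps)
qed

lemma deg_le_monom: "deg_le (poly_to_K (monom c m)) (int m)"
  by (auto simp: deg_le_def poly_to_K_nth)

lemma coeff_at_monom: "coeff_at (poly_to_K (monom c m)) (int m) = c"
  by (simp add: coeff_at_def poly_to_K_nth)

text \<open>The non-archimedean analogue of rounding to an integer: truncating the series leaves an error
  of absolute value at most \<open>1/q\<close>.\<close>

lemma polynomial_part_exists:
  fixes f :: "'a::field fls"
  shows "\<exists>p. deg_le (f - poly_to_K p) (- 1)"
proof
  define p where "p = Poly (map (\<lambda>i. fls_nth f (- int i)) [0..<Suc (nat (- fls_subdegree f))])"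
  have "coeff p i = fls_nth f (- int i)" for i
    by (cases "i < Suc (nat (- fls_subdegree f))")
      (auto simp: p_def nth_default_def simp del: upt_Suc intro!: fls_eq0_below_subdegree[symmetric])
  then show "deg_le (f - poly_to_K p) (- 1)"
    by (auto simp: deg_le_def poly_to_K_nth)
qed

text \<open>Lattices are used below only through their closure under polynomial combinations.\<close>

definition poly_submodule :: "('a::field fls ^ 'd) set \<Rightarrow> bool" where
  "poly_submodule M \<longleftrightarrow>
     0 \<in> M \<and> (\<forall>u\<in>M. \<forall>v\<in>M. u + v \<in> M) \<and> (\<forall>p. \<forall>u\<in>M. poly_to_K p *s u \<in> M)"

lemma poly_submodule_add: "poly_submodule M \<Longrightarrow> u \<in> M \<Longrightarrow> v \<in> M \<Longrightarrow> u + v \<in> M"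
  by (auto simp: poly_submodule_def)

lemma poly_submodule_scale: "poly_submodule M \<Longrightarrow> u \<in> M \<Longrightarrow> poly_to_K p *s u \<in> M"
  by (auto simp: poly_submodule_def)

lemma poly_submodule_sum:
  assumes "poly_submodule M" "\<And>i. i \<in> S \<Longrightarrow> f i \<in> M"
  shows "(\<Sum>i\<in>S. f i) \<in> M"
  using assms(2)
  by (induction S rule: infinite_finite_induct)
    (use assms(1) in \<open>auto simp: poly_submodule_def\<close>)

lemma poly_submodule_integer_vectors: "poly_submodule (integer_vectors :: ('a::field fls ^ 'd::finite) set)"
proof -
  have "0 \<in> range (poly_to_K :: 'a poly \<Rightarrow> _)"
    using poly_to_K_0 by (metis rangeI)
  moreover have "x + y \<in> range poly_to_K" if "x \<in> range poly_to_K" "y \<in> range poly_to_K" for x y :: "'a fls"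
    using that by (auto simp flip: poly_to_K_add)
  moreover have "poly_to_K p * y \<in> range poly_to_K" if "y \<in> range poly_to_K" for p and y :: "'a fls"
    using that by (auto simp flip: poly_to_K_mult)
  ultimately show ?thesis
    by (simp add: poly_submodule_def integer_vectors_def)
qed

lemma poly_submodule_image:
  fixes g :: "'a::field fls ^ 'd::finite ^ 'd"
  assumes "poly_submodule M"
  shows "poly_submodule ((\<lambda>v. g *v v) ` M)"
proof -
  have "0 \<in> (\<lambda>v. g *v v) ` M"
    using assms by (force simp: poly_submodule_def intro: image_eqI[where x = 0])
  moreover have "g *v u + g *v v \<in> (\<lambda>v. g *v v) ` M" if "u \<in> M" "v \<in> M" for u v
    using poly_submodule_add[OF assms that] by (metis imageI matrix_vector_right_distrib)
  moreover have "poly_to_K p *s (g *v u) \<in> (\<lambda>v. g *v v) ` M" if "u \<in> M" for u p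
    using poly_submodule_scale[OF assms that, of p] by (metis imageI matrix_vector_mult_scaleR vector_scalar_commute)
  ultimately show ?thesis
    by (auto simp: poly_submodule_def)
qed

section \<open>Frames with bounded degrees\<close>

text \<open>A frame is stored as a matrix whose \<^emph>\<open>rows\<close> are elements of \<open>M\<close>. Fixing the determinant
  at a nonzero \<open>D\<close> is what keeps the rows independent while they are modified and bounds the total
  weight from below.\<close>

definition bounded_frame ::
  "('a::field fls ^ 'd::finite) set \<Rightarrow> 'a fls \<Rightarrow> ('d \<Rightarrow> int) \<Rightarrow> ('d \<Rightarrow> int) \<Rightarrow> 'a fls ^ 'd ^ 'd \<Rightarrow> bool"
  where "bounded_frame M D n e B \<longleftrightarrow>
    (\<forall>k. B $ k \<in> M) \<and> det B = D \<and> (\<forall>k l. deg_le (B $ k $ l) (n l + e k))"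

lemma row_eq_nth: "row k A = A $ k"
  by (simp add: row_def vec_eq_iff)

lemma det_add_span_row:
  fixes A :: "'a::field ^ 'd::finite ^ 'd"
  shows "det (\<chi> k. if k = j then A $ j + (\<Sum>i\<in>UNIV - {j}. c i *s A $ i) else A $ k) = det A"
proof -
  have "(\<Sum>i\<in>UNIV - {j}. c i *s A $ i) \<in> vec.span {row i A |i. i \<noteq> j}"
    by (intro vec.span_sum vec.span_scale vec.span_base) (auto simp: row_eq_nth)
  from det_row_span[OF this] show ?thesis
    unfolding row_eq_nth .
qed

lemma det_add_row_multiples:
  fixes A :: "'a::comm_ring_1 ^ 'd::finite ^ 'd"
  shows "det (\<chi> k. if k = j then A $ k else A $ k + c k *s A $ j) = det A"
proof -
  have "det (\<chi> k. if k \<in> S then A $ k + c k *s A $ j else A $ k) = det A" if "j \<notin> S" "finite S" for S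
    using that(2,1)
  proof (induction rule: finite_induct)
    case empty
    show ?case by simp
  next
    case (insert i S)
    let ?A = "\<chi> k. if k \<in> S then A $ k + c k *s A $ j else A $ k"
    have "(\<chi> k. if k \<in> insert i S then A $ k + c k *s A $ j else A $ k) =
      (\<chi> k. if k = i then row i ?A + c i *s row j ?A else row k ?A)"
      using insert by (auto simp: vec_eq_iff row_eq_nth)
    then show ?case
      using insert det_row_operation[of i j ?A "c i"] by auto
  qed
  from this[of "- {j}"]
  have "det (\<chi> k. if k \<in> - {j} then A $ k + c k *s A $ j else A $ k) = det A" by simp
  also have "(\<chi> k. if k \<in> - {j} then A $ k + c k *s A $ j else A $ k) =
    (\<chi> k. if k = j then A $ k else A $ k + c k *s A $ j)"
    by (auto simp: vec_eq_iff)
  finally show ?thesis .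
qed

text \<open>Hadamard's inequality in the present setting; it is what makes the reduction terminate.\<close>

lemma weight_sum_nonneg:
  assumes "bounded_frame M D n e B" "coeff_at D 0 \<noteq> 0"
  shows "0 \<le> sum n UNIV + sum e UNIV"
  using assms deg_le_det[of B n e] coeff_at_eq_0[of D _ 0]
  unfolding bounded_frame_def by (metis not_le)

text \<open>The leading matrix has determinant \<open>0\<close>, because \<open>D\<close> has no coefficient in the positive
  degree \<open>\<Sum> n + \<Sum> e\<close>. Multiplying the rows in a relation \<open>\<Sum> c\<^sub>k C\<^sub>k = 0\<close> of the leading matrix by
  suitable powers of \<open>x\<close> brings them to a common weight, and then their leading terms cancel.\<close>

lemma lower_row_weight:
  fixes B :: "'a::field fls ^ 'd::finite ^ 'd"
  assumes M: "poly_submodule M" and D: "deg_le D 0"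
    and B: "bounded_frame M D n e B" and pos: "0 < sum n UNIV + sum e UNIV"
  shows "\<exists>B' j. bounded_frame M D n (e(j := e j - 1)) B'"
proof -
  let ?C = "\<chi> k l. coeff_at (B $ k $ l) (n l + e k)"
  have mem: "B $ k \<in> M" and det: "det B = D" and deg: "deg_le (B $ k $ l) (n l + e k)" for k l
    using B by (auto simp: bounded_frame_def)
  have "det ?C = 0"
    using coeff_at_det[OF deg] coeff_at_eq_0[OF D pos] det by simp
  then obtain c j0 where c: "(\<Sum>k\<in>UNIV. c k *s row k ?C) = 0" "c j0 \<noteq> 0"
    using matrix_right_invertible_independent_rows[of ?C] invertible_det_nz[of ?C]
    unfolding invertible_right_inverse by blast
  (* The row to be replaced has the largest weight among those in the relation, so that the
     others are multiplied by nonnegative powers of x, that is, by polynomials. Its own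
     coefficient is normalised to 1 in order to preserve the determinant. *)
  obtain j where j: "c j \<noteq> 0" "\<And>k. c k \<noteq> 0 \<Longrightarrow> e k \<le> e j"
  proof -
    have "Max (e ` {k. c k \<noteq> 0}) \<in> e ` {k. c k \<noteq> 0}"
      using c(2) by (intro Max_in) auto
    then show thesis
      using that by (metis (mono_tags, lifting) Max_ge finite finite_imageI image_iff mem_Collect_eq)
  qed
  define t where "t k = poly_to_K (monom (c k / c j) (nat (e j - e k)))" for k
  define w where "w = B $ j + (\<Sum>k\<in>UNIV - {j}. t k *s B $ k)"
  define B' where "B' = (\<chi> k. if k = j then w else B $ k)"
  have scaled: "deg_le (t k * B $ k $ l) (n l + e j)"
    "coeff_at (t k * B $ k $ l) (n l + e j) = c k / c j * ?C $ k $ l" for k l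
  proof -
    have "deg_le (t k * B $ k $ l) (n l + e j) \<and>
      coeff_at (t k * B $ k $ l) (n l + e j) = c k / c j * ?C $ k $ l"
    proof (cases "c k = 0")
      case True
      then show ?thesis by (simp add: t_def poly_to_K_0 deg_le_def coeff_at_def)
    next
      case False
      then have eq: "int (nat (e j - e k)) + (n l + e k) = n l + e j"
        using j(2) by simp
      show ?thesis
        using deg_le_mult[OF deg_le_monom deg, of "c k / c j" "nat (e j - e k)" k l]
          coeff_at_mult[OF deg_le_monom deg, of "c k / c j" "nat (e j - e k)" k l]
        by (simp only: t_def eq coeff_at_monom vec_lambda_beta)
    qed
    then show "deg_le (t k * B $ k $ l) (n l + e j)"
      "coeff_at (t k * B $ k $ l) (n l + e j) = c k / c j * ?C $ k $ l" by auto
  qed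
  have w_nth: "w $ l = (\<Sum>k\<in>UNIV. t k * B $ k $ l)" for l
  proof -
    have "t j = 1"
      using j(1) by (simp add: t_def poly_to_K_1 flip: one_pCons)
    then show ?thesis
      by (simp add: w_def sum.remove[of UNIV j])
  qed
  have "deg_le (w $ l) (n l + e j - 1)" for l
  proof (rule deg_le_pred)
    show "deg_le (w $ l) (n l + e j)"
      unfolding w_nth by (intro deg_le_sum scaled(1))
    have "coeff_at (w $ l) (n l + e j) = (\<Sum>k\<in>UNIV. c k * ?C $ k $ l) / c j"
      unfolding w_nth coeff_at_sum scaled(2) by (simp add: sum_divide_distrib)
    also have "(\<Sum>k\<in>UNIV. c k * ?C $ k $ l) = (\<Sum>k\<in>UNIV. c k *s row k ?C) $ l"
      by (simp add: row_eq_nth)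
    finally show "coeff_at (w $ l) (n l + e j) = 0"
      using c(1) by simp
  qed
  moreover have "w \<in> M"
    unfolding w_def t_def
    by (intro poly_submodule_add[OF M] poly_submodule_sum[OF M] poly_submodule_scale[OF M] mem)
  moreover have "det B' = D"
    using det_add_span_row[of j B t] det unfolding B'_def w_def by (rule trans)
  ultimately have "bounded_frame M D n (e(j := e j - 1)) B'"
    using mem deg by (auto simp: bounded_frame_def B'_def algebra_simps)
  then show ?thesis by blast
qed

lemma sum_fun_upd:
  fixes f :: "'d::finite \<Rightarrow> int"
  shows "sum (f(j := x)) UNIV = sum f UNIV - f j + x"
  by (simp add: sum.remove[of UNIV j])

lemma reduced_frame_exists:
  fixes B :: "'a::field fls ^ 'd::finite ^ 'd"
  assumes M: "poly_submodule M" and D: "deg_le D 0" "coeff_at D 0 \<noteq> 0"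
    and B: "bounded_frame M D n e B"
  shows "\<exists>e' B'. bounded_frame M D n e' B' \<and> sum n UNIV + sum e' UNIV = 0"
  using B
proof (induction "nat (sum n UNIV + sum e UNIV)" arbitrary: e B rule: less_induct)
  case less
  have nonneg: "0 \<le> sum n UNIV + sum e UNIV"
    by (rule weight_sum_nonneg[OF less.prems D(2)])
  show ?case
  proof (cases "sum n UNIV + sum e UNIV = 0")
    case True
    then show ?thesis using less.prems by blast
  next
    case False
    with nonneg have pos: "0 < sum n UNIV + sum e UNIV" by simp
    obtain B' j where "bounded_frame M D n (e(j := e j - 1)) B'"
      using lower_row_weight[OF M D(1) less.prems pos] by blast
    then show ?thesis
      by (rule less.hyps[rotated]) (use pos in \<open>unfold sum_fun_upd, simp\<close>)
  qed
qed

text \<open>This step changes the box and is the counterpart of moving the lattice by a diagonal matrix.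
  Once the coordinate \<open>i\<close> no longer carries leading terms outside the pivot row \<open>j\<close>, the bound
  \<open>n i\<close> can be lowered for all other rows; raising \<open>e j\<close> makes up for it in the pivot row.
  Minimality of \<open>e j\<close> ensures that the multipliers used for clearing are polynomials.\<close>

lemma transfer_weight:
  fixes B :: "'a::field fls ^ 'd::finite ^ 'd"
  assumes M: "poly_submodule M" and D: "coeff_at D 0 \<noteq> 0"
    and B: "bounded_frame M D n e B" and total: "sum n UNIV + sum e UNIV = 0"
    and j: "\<And>k. e j \<le> e k"
  shows "\<exists>i B'. bounded_frame M D (n(i := n i - 1)) (e(j := e j + 1)) B'"
proof -
  let ?C = "\<chi> k l. coeff_at (B $ k $ l) (n l + e k)"
  have mem: "B $ k \<in> M" and det: "det B = D" and deg: "deg_le (B $ k $ l) (n l + e k)" for k l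
    using B by (auto simp: bounded_frame_def)
  have "det ?C \<noteq> 0"
    using coeff_at_det[OF deg] D det total by simp
  then have "row j ?C \<noteq> 0"
    using det_zero_row(2) by blast
  then obtain i where i: "coeff_at (B $ j $ i) (n i + e j) \<noteq> 0"
    by (auto simp: row_eq_nth vec_eq_iff)
  define t where "t k = poly_to_K (monom (- (?C $ k $ i) / ?C $ j $ i) (nat (e k - e j)))" for k
  define B' where "B' = (\<chi> k. if k = j then B $ k else B $ k + t k *s B $ j)"
  have scaled: "deg_le (t k * B $ j $ l) (n l + e k)"
    "coeff_at (t k * B $ j $ l) (n l + e k) = - (?C $ k $ i) / ?C $ j $ i * ?C $ j $ l" for k l
  proof -
    have eq: "int (nat (e k - e j)) + (n l + e j) = n l + e k"
      using j[of k] by simp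
    show "deg_le (t k * B $ j $ l) (n l + e k)"
      using deg_le_mult[OF deg_le_monom deg, of _ "nat (e k - e j)" j l] by (simp only: t_def eq)
    show "coeff_at (t k * B $ j $ l) (n l + e k) = - (?C $ k $ i) / ?C $ j $ i * ?C $ j $ l"
      using coeff_at_mult[OF deg_le_monom deg, of _ "nat (e k - e j)" j l]
      by (simp only: t_def eq coeff_at_monom vec_lambda_beta)
  qed
  have others: "deg_le (B' $ k $ l) ((n(i := n i - 1)) l + e k)" if "k \<noteq> j" for k l
  proof -
    have B'_nth: "B' $ k $ l = B $ k $ l + t k * B $ j $ l"
      using that by (simp add: B'_def)
    have le: "deg_le (B' $ k $ l) (n l + e k)"
      unfolding B'_nth by (intro deg_le_add deg scaled(1))
    show ?thesis
    proof (cases "l = i")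
      case True
      have "coeff_at (B' $ k $ l) (n l + e k) = 0"
        unfolding B'_nth coeff_at_add scaled(2) using i True by simp
      from deg_le_pred[OF le this] show ?thesis
        using True by (simp add: algebra_simps)
    qed (use le in simp)
  qed
  have "deg_le (B' $ j $ l) ((n(i := n i - 1)) l + (e j + 1))" for l
    using deg[of j l] by (auto simp: B'_def intro: deg_le_mono)
  moreover have "B' $ k \<in> M" for k
    using mem poly_submodule_add[OF M] poly_submodule_scale[OF M] by (simp add: B'_def t_def)
  moreover have "det B' = D"
    using det_add_row_multiples[of j B t] det by (simp add: B'_def)
  ultimately have "bounded_frame M D (n(i := n i - 1)) (e(j := e j + 1)) B'"
    using others by (auto simp: bounded_frame_def)
  then show ?thesis by blast
qed

text \<open>If \<open>\<Sum> n > 0\<close>, then \<open>\<Sum> e < 0\<close>, so the smallest weight is negative and stays \<open>\<le> 0\<close> after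
  being raised by one. Thus the sign condition persists while \<open>\<Sum> n\<close> decreases; at \<open>\<Sum> n = 0\<close>
  the weights are nonpositive with sum \<open>0\<close>, hence all zero.\<close>

lemma balanced_frame_of_reduced:
  fixes B :: "'a::field fls ^ 'd::finite ^ 'd"
  assumes M: "poly_submodule M" and D: "coeff_at D 0 \<noteq> 0"
    and "bounded_frame M D n e B" "sum n UNIV + sum e UNIV = 0" "\<And>k. e k \<le> 0"
  shows "\<exists>n' B'. bounded_frame M D n' (\<lambda>_. 0) B' \<and> sum n' UNIV = 0"
  using assms(3-)
proof (induction "nat (sum n UNIV)" arbitrary: n e B rule: less_induct)
  case less
  have nonneg: "0 \<le> sum n UNIV"
    using less.prems(2) sum_nonpos[of UNIV e] less.prems(3) by simp
  show ?case
  proof (cases "sum n UNIV = 0")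
    case True
    then have "(\<Sum>k\<in>UNIV. - e k) = 0"
      using less.prems(2) by (simp add: sum_negf)
    then have "e = (\<lambda>_. 0)"
      using less.prems(3) by (subst (asm) sum_nonneg_eq_0_iff) auto
    then show ?thesis using less.prems(1) True by blast
  next
    case False
    with nonneg have pos: "0 < sum n UNIV" by simp
    obtain j where j: "\<And>k. e j \<le> e k"
    proof -
      have "Min (range e) \<in> range e" by (intro Min_in) auto
      then show thesis using that by (metis Min_le finite finite_imageI imageE rangeI)
    qed
    have neg: "e j < 0"
      using pos less.prems(2) sum_nonneg[of UNIV e] j by (smt (verit))
    obtain i B' where B': "bounded_frame M D (n(i := n i - 1)) (e(j := e j + 1)) B'"
      using transfer_weight[OF M D less.prems(1,2) j] by blast
    show ?thesis
      by (rule less.hyps[OF _ B']) (use pos neg less.prems(2,3) in \<open>unfold sum_fun_upd, auto\<close>)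
  qed
qed

lemma balanced_frame_exists:
  fixes A :: "'a::field fls ^ 'd::finite ^ 'd"
  assumes M: "poly_submodule M" and A: "\<And>k. A $ k \<in> M"
    and D: "deg_le (det A) 0" "coeff_at (det A) 0 \<noteq> 0"
  shows "\<exists>n B. bounded_frame M (det A) n (\<lambda>_. 0) B \<and> sum n UNIV = 0"
proof -
  define s where "s k = (\<Sum>l\<in>UNIV. \<bar>fls_subdegree (A $ k $ l)\<bar>)" for k
  have "deg_le (A $ k $ l) (0 + s k)" for k l
    using member_le_sum[of l UNIV "\<lambda>l. \<bar>fls_subdegree (A $ k $ l)\<bar>"]
    by (auto simp: deg_le_iff s_def)
  then have "bounded_frame M (det A) (\<lambda>_. 0) s A"
    using A by (simp add: bounded_frame_def)
  from reduced_frame_exists[OF M D this] obtain e B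
    where B: "bounded_frame M (det A) (\<lambda>_. 0) e B" and e: "sum e UNIV = 0" by auto
  (* Only the sums n l + e k matter for the degree bounds, so a constant may be moved from e to n;
     this one makes all weights nonpositive. *)
  define t where "t = Max (range e)"
  have "e k - t \<le> 0" for k by (simp add: t_def)
  moreover have "bounded_frame M (det A) (\<lambda>_. t) (\<lambda>k. e k - t) B"
    using B by (simp add: bounded_frame_def)
  moreover have "sum (\<lambda>_. t) (UNIV :: 'd set) + (\<Sum>k\<in>UNIV. e k - t) = 0"
    using e by (simp add: sum_subtractf)
  ultimately show ?thesis
    using balanced_frame_of_reduced[OF M D(2)] by blast
qed

section \<open>Covering by a box\<close>

lemma box_approximation:
  fixes B :: "'a::field fls ^ 'd::finite ^ 'd"
  assumes M: "poly_submodule M" and D: "D \<noteq> 0" and B: "bounded_frame M D n (\<lambda>_. 0) B"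
  shows "\<exists>u\<in>M. \<forall>l. deg_le ((v - u) $ l) (n l - 1)"
proof -
  have mem: "B $ k \<in> M" and deg: "deg_le (B $ k $ l) (n l)" for k l
    using B by (auto simp: bounded_frame_def)
  have "invertible (transpose B)"
    using B D by (simp add: bounded_frame_def invertible_det_nz)
  then obtain A where "transpose B ** A = mat 1"
    by (auto simp: invertible_right_inverse)
  then have "transpose B *v (A *v v) = v"
    by (metis matrix_vector_mul_assoc matrix_vector_mul_lid)
  then obtain y where y: "transpose B *v y = v" by blast
  obtain p where p: "\<And>k. deg_le (y $ k - poly_to_K (p k)) (- 1)"
    using choice[of "\<lambda>k p. deg_le (y $ k - poly_to_K p) (- 1)"] polynomial_part_exists by blast
  define u where "u = (\<Sum>k\<in>UNIV. poly_to_K (p k) *s B $ k)"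
  have "u \<in> M"
    unfolding u_def by (intro poly_submodule_sum[OF M] poly_submodule_scale[OF M] mem)
  moreover have "deg_le ((v - u) $ l) (n l - 1)" for l
  proof -
    have "(v - u) $ l = (\<Sum>k\<in>UNIV. (y $ k - poly_to_K (p k)) * B $ k $ l)"
      by (simp add: u_def y[symmetric] matrix_vector_mult_def transpose_def
          algebra_simps sum_subtractf del: transpose_matrix_vector)
    also have "deg_le \<dots> (- 1 + n l)"
      by (intro deg_le_sum deg_le_mult p deg)
    finally show ?thesis by simp
  qed
  ultimately show ?thesis by blast
qed

lemma K_abs_le:
  fixes f :: "'a::{field,finite} fls"
  assumes "deg_le f m"
  shows "K_abs f \<le> real CARD('a) powi m"
  using assms by (auto simp: deg_le_iff K_abs_def intro!: power_int_increasing)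

lemma K_abs_nonneg: "0 \<le> K_abs f"
  by (simp add: K_abs_def)

lemma vec_N_le:
  fixes w :: "'a::{field,finite} fls ^ 'd::finite"
  assumes "\<And>l. deg_le (w $ l) (m l)"
  shows "vec_N w \<le> real CARD('a) powi (sum m UNIV)"
proof -
  have "vec_N w \<le> (\<Prod>l\<in>UNIV. real CARD('a) powi m l)"
    unfolding vec_N_def by (intro prod_mono conjI K_abs_nonneg K_abs_le assms)
  also have "\<dots> = real CARD('a) powi (sum m UNIV)"
  proof -
    have "(\<Prod>l\<in>S. real CARD('a) powi m l) = real CARD('a) powi (sum m S)" for S :: "'d set"
      using finite[of S] by (induction rule: finite_induct) (auto simp: power_int_add)
    then show ?thesis .
  qed
  finally show ?thesis .
qed

lemma K_abs_eq_1D: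
  fixes f :: "'a::{field,finite} fls"
  assumes "K_abs f = 1"
  shows "deg_le f 0" "coeff_at f 0 \<noteq> 0"
proof -
  have f: "f \<noteq> 0" "real CARD('a) powi (- fls_subdegree f) = 1"
    using assms by (auto simp: K_abs_def split: if_splits)
  have "1 < real CARD('a)"
    using card_mono[of UNIV "{0, 1 :: 'a}"] by simp
  with f(2) have "fls_subdegree f = 0"
    by (smt (verit) power_int_0_right power_int_strict_increasing)
  with f(1) show "deg_le f 0" "coeff_at f 0 \<noteq> 0"
    using nth_fls_subdegree_nonzero[OF f(1)] by (auto simp: deg_le_iff coeff_at_def)
qed

theorem theorem1p28:
  fixes L :: "('a::{field,finite} fls ^ 'd::finite) set"
  assumes "CARD('d) \<ge> 2"
    and "L \<in> unimodular_lattices"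
  shows "minkowski_mu L \<le> ennreal (1 / real CARD('a) ^ CARD('d))"
proof -
  obtain g :: "'a fls ^ 'd ^ 'd"
    where L: "L = (\<lambda>v. g *v v) ` integer_vectors" and g: "K_abs (det g) = 1"
    using assms(2) by (auto simp: unimodular_lattices_def)
  have M: "poly_submodule L"
    unfolding L by (intro poly_submodule_image poly_submodule_integer_vectors)
  (* The columns of g generate L; frames are stored by rows, hence the transpose. *)
  have "transpose g $ k \<in> L" for k
  proof -
    have "axis k 1 \<in> (integer_vectors :: ('a fls ^ 'd) set)"
      using rangeI[of poly_to_K "0 :: 'a poly"] rangeI[of poly_to_K "1 :: 'a poly"]
      by (simp add: integer_vectors_def axis_def poly_to_K_0 poly_to_K_1)
    moreover have "transpose g $ k = g *v axis k 1"
      by (simp add: matrix_vector_mult_def axis_def transpose_def vec_eq_iff if_distrib cong: if_cong)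
    ultimately show ?thesis unfolding L by blast
  qed
  then obtain n B where B: "bounded_frame L (det g) n (\<lambda>_. 0) B" and n: "sum n UNIV = 0"
    using balanced_frame_exists[OF M, of "transpose g"] K_abs_eq_1D[OF g] by auto
  have "det g \<noteq> 0" using g by (auto simp: K_abs_def)
  have "(INF u\<in>L. ennreal (vec_N (v - u))) \<le> ennreal (1 / real CARD('a) ^ CARD('d))" for v
  proof -
    obtain u where u: "u \<in> L" "\<And>l. deg_le ((v - u) $ l) (n l - 1)"
      using box_approximation[OF M \<open>det g \<noteq> 0\<close> B, of v] by blast
    have "vec_N (v - u) \<le> real CARD('a) powi (\<Sum>l\<in>UNIV. n l - 1)"
      by (rule vec_N_le) (rule u(2))
    also have "(\<Sum>l\<in>UNIV. n l - 1) = - int CARD('d)"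
      using n by (simp add: sum_subtractf)
    also have "real CARD('a) powi (- int CARD('d)) = 1 / real CARD('a) ^ CARD('d)"
      by (simp add: power_int_minus divide_inverse)
    finally show ?thesis
      using u(1) by (intro INF_lower2[of u] ennreal_leI)
  qed
  then show ?thesis
    unfolding minkowski_mu_def by (intro SUP_least)
qed

end
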